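(* The class $\mathcal{L}_2$ of permutations that are sums of at most two decreasing permutations is not composable.
   Context: A permutation of order $n$ is a bijection $\pi:[n]\to[n]$, where $[n]=\{1,\dots,n\}$, also viewed as the sequence $\pi(1),\dots,\pi(n)$; the empty permutation is allowed. A permutation $\pi$ is contained in $\sigma$ if $\sigma$ has a (not necessarily contiguous) subsequence in the same relative order as $\pi$. A permutation class is a set of permutations closed downwards under containment. For permutations of the same order, $(\pi\circ\sigma)(i)=\pi(\sigma(i))$. For permutation classes, $\mathcal{A}\circ\mathcal{B}=\{\pi\circ\varphi : \pi\in\mathcal{A},\varphi\in\mathcal{B},|\pi|=|\varphi|\}$; this is an associative operation on permutation classes. A class $\mathcal{C}$ is $k$-composable if there are permutation classes $\mathcal{C}_1,\dots,\mathcal{C}_k\subsetneq\mathcal{C}$ (repetitions allowed) with $\mathcal{C}\subseteq\mathcal{C}_1\circ\cdots\circ\mathcal{C}_k$; it is composable if it is $k$-composable for some $k\ge2$. The sum $\pi\oplus\sigma$ of $\pi$ of order $k$ and $\sigma$ of order $l$ is the permutation $\pi(1),\dots,\pi(k),\sigma(1)+k,\dots,\sigma(l)+k$. A permutation is decreasing if it is $n,n-1,\dots,1$ for some $n$. *)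

theory Defs
  imports "HOL-Combinatorics.Permutations"
begin

text \<open>
  A permutation of order \<open>n\<close> is a pair \<open>(n, p)\<close> with \<open>p permutes {1..n}\<close>. Since \<open>permutes\<close> fixes
  all points outside \<open>{1..n}\<close>, bijections of \<open>{1..n}\<close> correspond one-to-one to such \<open>p\<close>; the order
  has to be recorded, as the same function \<open>p\<close> also permutes larger intervals.
  The empty permutation is \<open>(0, id)\<close>.
\<close>

type_synonym fperm = "nat \<times> (nat \<Rightarrow> nat)"

definition fperms :: "fperm set" where
  "fperms = {(n, p). p permutes {1..n}}"

fun contained :: "fperm \<Rightarrow> fperm \<Rightarrow> bool" where
  "contained (m, p) (n, q) \<longleftrightarrow>
     (\<exists>e. strict_mono_on {1..m} e \<and> e ` {1..m} \<subseteq> {1..n} \<and>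
          (\<forall>i\<in>{1..m}. \<forall>j\<in>{1..m}. p i < p j \<longleftrightarrow> q (e i) < q (e j)))"

definition perm_class :: "fperm set \<Rightarrow> bool" where
  "perm_class C \<longleftrightarrow> C \<subseteq> fperms \<and> (\<forall>s\<in>C. \<forall>r\<in>fperms. contained r s \<longrightarrow> r \<in> C)"

definition class_comp :: "fperm set \<Rightarrow> fperm set \<Rightarrow> fperm set" where
  "class_comp A B = {(n, p \<circ> q) | n p q. (n, p) \<in> A \<and> (n, q) \<in> B}"

text \<open>
  The empty composition is the class of all identity permutations, which is neutral for
  \<^const>\<open>class_comp\<close> (see below).
\<close>

definition class_comps :: "fperm set list \<Rightarrow> fperm set" where
  "class_comps Cs = foldr class_comp Cs {(n, id) | n. True}"

definition k_composable :: "nat \<Rightarrow> fperm set \<Rightarrow> bool" where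
  "k_composable k C \<longleftrightarrow>
     (\<exists>Cs. length Cs = k \<and> (\<forall>D\<in>set Cs. perm_class D \<and> D \<subset> C) \<and> C \<subseteq> class_comps Cs)"

definition composable :: "fperm set \<Rightarrow> bool" where
  "composable C \<longleftrightarrow> (\<exists>k\<ge>2. k_composable k C)"

fun perm_sum :: "fperm \<Rightarrow> fperm \<Rightarrow> fperm" where
  "perm_sum (k, p) (l, q) = (k + l, \<lambda>i. if i \<le> k then p i else q (i - k) + k)"

definition decr_perm :: "nat \<Rightarrow> fperm" where
  "decr_perm n = (n, \<lambda>i. if i \<in> {1..n} then n + 1 - i else i)"

definition decreasing_perms :: "fperm set" where
  "decreasing_perms = range decr_perm"

definition layered :: "nat \<Rightarrow> fperm set" where
  "layered k = {foldr perm_sum ds (0, id) | ds. length ds \<le> k \<and> set ds \<subseteq> decreasing_perms}"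

lemma class_comp_identity_right: "class_comp A {(n, id) | n. True} = A"
  by (auto simp: class_comp_def)

lemma class_comp_identity_left: "class_comp {(n, id) | n. True} A = A"
  by (auto simp: class_comp_def)

lemma class_comp_assoc: "class_comp (class_comp A B) C = class_comp A (class_comp B C)"
  unfolding class_comp_def by (auto simp: o_assoc) (metis o_assoc)+

lemma class_comps_simps:
  "class_comps [A] = A"
  "class_comps (A # Cs) = class_comp A (class_comps Cs)"
  by (simp_all only: class_comps_def foldr.simps comp_apply id_apply class_comp_identity_right)

lemma decr_perm_in_fperms: "decr_perm n \<in> fperms"
proof -
  have "bij_betw (\<lambda>i. if i \<in> {1..n} then n + 1 - i else i) {1..n} {1..n}"
    by (rule bij_betw_byWitness[where f' = "\<lambda>i. n + 1 - i"]) auto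
  then show ?thesis
    unfolding decr_perm_def fperms_def by (auto intro: bij_imp_permutes)
qed

lemma perm_sum_in_fperms:
  assumes "r \<in> fperms" "s \<in> fperms"
  shows "perm_sum r s \<in> fperms"
proof -
  obtain k p l q where eq: "r = (k, p)" "s = (l, q)" by fastforce
  then have p: "p permutes {1..k}" and q: "q permutes {1..l}"
    using assms by (auto simp: fperms_def)
  let ?f = "\<lambda>i. if i \<le> k then p i else q (i - k) + k"
  have pk: "p i \<le> k \<longleftrightarrow> i \<le> k" for i
    using permutes_in_image[OF p, of i] permutes_not_in[OF p, of i]
    by (cases "i = 0") auto
  have q0: "q i = 0 \<longleftrightarrow> i = 0" for i
    using permutes_in_image[OF q, of i] permutes_not_in[OF q, of i]
    by (cases "i = 0") auto
  have "inj ?f"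
  proof (rule injI)
    fix i j assume h: "?f i = ?f j"
    show "i = j"
    proof (cases "i \<le> k"; cases "j \<le> k")
      assume "i \<le> k" "j \<le> k"
      then show ?thesis using h permutes_inj[OF p] by (auto dest: injD)
    next
      assume "\<not> i \<le> k" "\<not> j \<le> k"
      then show ?thesis using h permutes_inj[OF q] by (auto dest!: injD)
    next
      assume a: "i \<le> k" "\<not> j \<le> k"
      then have "p i \<le> k" "q (j - k) \<noteq> 0" using pk q0 by auto
      then show ?thesis using a h by auto
    next
      assume a: "\<not> i \<le> k" "j \<le> k"
      then have "p j \<le> k" "q (i - k) \<noteq> 0" using pk q0 by auto
      then show ?thesis using a h by auto
    qed
  qed
  moreover have fix1: "?f i = i" if "i \<notin> {1..k + l}" for i
  proof (cases "i \<le> k")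
    case True
    then have "i = 0" using that by auto
    then show ?thesis using permutes_not_in[OF p, of 0] by simp
  next
    case False
    then have "i - k \<notin> {1..l}" using that by auto
    then show ?thesis using False permutes_not_in[OF q, of "i - k"] by simp
  qed
  moreover have "?f i \<in> {1..k + l}" if i: "i \<in> {1..k + l}" for i
  proof (rule ccontr)
    assume "?f i \<notin> {1..k + l}"
    then have "?f (?f i) = ?f i" by (intro fix1)
    then have "?f i = i" by (rule injD[OF \<open>inj ?f\<close>])
    then show False using i \<open>?f i \<notin> {1..k + l}\<close> by metis
  qed
  ultimately have "?f permutes {1..k + l}"
    by (intro inj_imp_permutes finite_atLeastAtMost) (rule inj_on_subset[OF _ subset_UNIV])
  then show ?thesis by (simp add: eq fperms_def)
qed

lemma layered_subset_fperms: "layered k \<subseteq> fperms"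
proof -
  have "foldr perm_sum ds (0, id) \<in> fperms" if "set ds \<subseteq> decreasing_perms" for ds
    using that
  proof (induction ds)
    case Nil
    show ?case by (simp add: fperms_def permutes_id[unfolded id_def] id_def)
  next
    case (Cons d ds)
    then show ?case
      by (auto simp: decreasing_perms_def intro!: perm_sum_in_fperms decr_perm_in_fperms)
  qed
  then show ?thesis by (auto simp: layered_def)
qed

end

theory Submission
  imports Defs "HOL-Number_Theory.Cong"
begin

text \<open>
  Modulo \<open>n\<close>, the sum of decreasing permutations of orders \<open>a\<close> and \<open>b = n - a\<close> is the reflection
  \<open>i \<mapsto> a + 1 - i\<close>. A proper subclass omits some such sum and hence every larger one, so in all its
  members \<open>a\<close> or \<open>b\<close> is bounded, and each is a reflection \<open>i \<mapsto> c - i\<close> with \<open>c\<close> bounded independently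
  of \<open>n\<close>. Composites of a fixed number of these are \<open>i \<mapsto> c \<plusminus> i\<close> with \<open>c\<close> still bounded, which
  excludes the sum of two decreasing permutations of the same large order.
\<close>

lemma layered_2_eq: "layered 2 = {perm_sum (decr_perm a) (decr_perm b) | a b. True}" (is "_ = ?R")
proof
  have one: "perm_sum x (0, id) = perm_sum x (decr_perm 0)" for x
    by (cases x) (auto simp: fun_eq_iff decr_perm_def)
  have nil: "(0, id) = perm_sum (decr_perm 0) (decr_perm 0)"
    by (auto simp: fun_eq_iff decr_perm_def)
  have two: "perm_sum (decr_perm b) (0, id) = decr_perm b" for b
    by (auto simp: fun_eq_iff decr_perm_def)
  show "layered 2 \<subseteq> ?R"
  proof
    fix s assume "s \<in> layered 2"
    then obtain ds where s: "s = foldr perm_sum ds (0, id)"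
      and len: "length ds \<le> 2" and ds: "set ds \<subseteq> decreasing_perms"
      by (auto simp: layered_def)
    consider "ds = []" | x where "ds = [x]" | x y where "ds = [x, y]"
      using len by (cases ds; cases "tl ds") auto
    then show "s \<in> ?R"
    proof cases
      case 1
      then show ?thesis using s nil by auto
    next
      case 2
      then show ?thesis using s ds one by (auto simp: decreasing_perms_def)
    next
      case 3
      then obtain a b where "x = decr_perm a" "y = decr_perm b"
        using ds by (auto simp: decreasing_perms_def)
      then have "s = perm_sum (decr_perm a) (decr_perm b)" using s 3 two by simp
      then show ?thesis by blast
    qed
  qed
  show "?R \<subseteq> layered 2"
  proof
    fix s assume "s \<in> ?R"
    then obtain a b where s: "s = perm_sum (decr_perm a) (decr_perm b)" by blast
    show "s \<in> layered 2"
      unfolding layered_def decreasing_perms_def s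
      by (intro CollectI exI[of _ "[decr_perm a, decr_perm b]"] conjI)
        (simp_all add: two)
  qed
qed

text \<open>The second block's value is written as \<open>n + a + 1 - i\<close> so that it visibly
  agrees with \<open>a + 1 - i\<close> modulo \<open>n\<close>.\<close>

lemma perm_sum_decr_perm:
  assumes "perm_sum (decr_perm a) (decr_perm b) = (n, p)"
  shows "n = a + b"
    and "i \<in> {1..n} \<Longrightarrow> p i = (if i \<le> a then a + 1 - i else n + a + 1 - i)"
  using assms by (auto simp: decr_perm_def)

lemma contained_perm_sum_decr_perm:
  assumes "a \<le> a'" "b \<le> b'"
  shows "contained (perm_sum (decr_perm a) (decr_perm b)) (perm_sum (decr_perm a') (decr_perm b'))"
proof -
  obtain m p where p: "perm_sum (decr_perm a) (decr_perm b) = (m, p)" by fastforce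
  obtain n q where q: "perm_sum (decr_perm a') (decr_perm b') = (n, q)" by fastforce
  \<comment> \<open>Each block goes to an initial segment of the corresponding larger block; the
    second one starts at \<open>a' + 1\<close>.\<close>
  define e where "e = (\<lambda>i. if i \<le> a then i else a' + i - a)"
  have "strict_mono_on {1..m} e"
    using assms by (auto simp: e_def strict_mono_on_def)
  moreover have e: "e ` {1..m} \<subseteq> {1..n}"
    using assms perm_sum_decr_perm(1)[OF p] perm_sum_decr_perm(1)[OF q] by (auto simp: e_def)
  moreover have "p i < p j \<longleftrightarrow> q (e i) < q (e j)" if "i \<in> {1..m}" "j \<in> {1..m}" for i j
  proof -
    have "e i \<in> {1..n}" "e j \<in> {1..n}" using e that by blast+
    then show ?thesis
      using that assms perm_sum_decr_perm(1)[OF p] perm_sum_decr_perm(1)[OF q]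
      by (auto simp: perm_sum_decr_perm(2)[OF p] perm_sum_decr_perm(2)[OF q] e_def)
  qed
  ultimately show ?thesis unfolding p q by auto
qed

text \<open>On residues modulo \<open>n\<close> these maps are symmetries of the regular
  \<open>n\<close>-gon. Every offset can be reduced modulo \<open>n\<close>, so the bound says
  something only when \<open>K\<close> is fixed before \<open>n\<close>.\<close>

definition dihedral_bounded :: "int \<Rightarrow> nat \<Rightarrow> (nat \<Rightarrow> nat) \<Rightarrow> bool" where
  "dihedral_bounded K n f \<longleftrightarrow>
     (\<exists>s c. (s = 1 \<or> s = -1) \<and> \<bar>c\<bar> \<le> K \<and>
        (\<forall>i\<in>{1..n}. f i \<in> {1..n} \<and> [int (f i) = s * int i + c] (mod int n)))"

text \<open>Substitution yields the sign \<open>s * t\<close> and the offset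
  \<open>s * d + c\<close>; since \<open>s\<close> is 1 or -1, the bounds add.\<close>

lemma dihedral_bounded_comp:
  assumes "dihedral_bounded K n f" "dihedral_bounded L n g"
  shows "dihedral_bounded (K + L) n (f \<circ> g)"
proof -
  obtain s c where s: "s = 1 \<or> s = -1" and c: "\<bar>c\<bar> \<le> K"
    and f: "\<And>i. i \<in> {1..n} \<Longrightarrow> f i \<in> {1..n} \<and> [int (f i) = s * int i + c] (mod int n)"
    using assms(1) unfolding dihedral_bounded_def by blast
  obtain t d where t: "t = 1 \<or> t = -1" and d: "\<bar>d\<bar> \<le> L"
    and g: "\<And>i. i \<in> {1..n} \<Longrightarrow> g i \<in> {1..n} \<and> [int (g i) = t * int i + d] (mod int n)"
    using assms(2) unfolding dihedral_bounded_def by blast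
  have "[int (f (g i)) = (s * t) * int i + (s * d + c)] (mod int n)" if "i \<in> {1..n}" for i
  proof -
    have "[int (f (g i)) = s * int (g i) + c] (mod int n)"
      using f g that by blast
    also have "[s * int (g i) + c = s * (t * int i + d) + c] (mod int n)"
      using g that by (intro cong_add cong_mult cong_refl) blast
    finally show ?thesis by (simp add: algebra_simps)
  qed
  then show ?thesis
    unfolding dihedral_bounded_def using s t c d f g
    by (intro exI[of _ "s * t"] exI[of _ "s * d + c"]) auto
qed

lemma proper_subclass_dihedral_bounded:
  assumes "perm_class D" "D \<subset> layered 2"
  obtains K where "\<And>n f. (n, f) \<in> D \<Longrightarrow> dihedral_bounded K n f"
proof -
  obtain a b where ab: "perm_sum (decr_perm a) (decr_perm b) \<notin> D"
    using assms(2) unfolding layered_2_eq by blast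
  have "dihedral_bounded (int (a + b)) n f" if nf: "(n, f) \<in> D" for n f
  proof -
    have "(n, f) \<in> layered 2" using nf assms(2) by blast
    then obtain a' b' where eq: "perm_sum (decr_perm a') (decr_perm b') = (n, f)"
      by (force simp: layered_2_eq simp del: perm_sum.simps)
    have n: "n = a' + b'" using perm_sum_decr_perm(1)[OF eq] .
    have less: "a' < a \<or> b' < b"
    proof (rule ccontr)
      assume "\<not> ?thesis"
      then have "contained (perm_sum (decr_perm a) (decr_perm b)) (n, f)"
        unfolding eq[symmetric] by (intro contained_perm_sum_decr_perm) auto
      then show False
        using ab assms(1) nf perm_sum_in_fperms decr_perm_in_fperms unfolding perm_class_def by blast
    qed
    \<comment> \<open>The offsets \<open>a' + 1\<close> and \<open>1 - b'\<close> differ by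
      \<open>n\<close>; the one chosen is controlled by the block known to be short.\<close>
    define c where "c = (if a' < a then int a' + 1 else 1 - int b')"
    have "[int (f i) = - 1 * int i + c] (mod int n)" if i: "i \<in> {1..n}" for i
    proof -
      \<comment> \<open>With offset \<open>a' + 1\<close> the two blocks give 0 and
        \<open>n\<close>; with \<open>1 - b'\<close> they give \<open>n\<close> and
        \<open>2 * n\<close>.\<close>
      have "int (f i) - (- 1 * int i + c) \<in> {0, int n, - int n, 2 * int n}"
        using i n by (auto simp: perm_sum_decr_perm(2)[OF eq i] c_def)
      then show ?thesis by (auto simp: cong_iff_dvd_diff)
    qed
    moreover have "f i \<in> {1..n}" if i: "i \<in> {1..n}" for i
      using i n by (auto simp: perm_sum_decr_perm(2)[OF eq i])
    moreover have "\<bar>c\<bar> \<le> int (a + b)"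
      using less by (auto simp: c_def)
    ultimately show ?thesis unfolding dihedral_bounded_def by blast
  qed
  then show ?thesis using that by blast
qed

text \<open>The bounds of the factors add up along the list, so a single \<open>K\<close> serves all
  orders \<open>n\<close>.\<close>

lemma class_comps_dihedral_bounded:
  assumes "\<forall>D\<in>set Cs. perm_class D \<and> D \<subset> layered 2"
  shows "\<exists>K. \<forall>n f. (n, f) \<in> class_comps Cs \<longrightarrow> dihedral_bounded K n f"
  using assms
proof (induction Cs)
  case Nil
  have "dihedral_bounded 0 n id" for n
    unfolding dihedral_bounded_def by (intro exI[of _ 1] exI[of _ 0]) auto
  then have "\<forall>n f. (n, f) \<in> class_comps [] \<longrightarrow> dihedral_bounded 0 n f"
    by (simp add: class_comps_def)
  then show ?case by blast
next
  case (Cons D Cs)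
  obtain K where "\<And>n f. (n, f) \<in> D \<Longrightarrow> dihedral_bounded K n f"
    using proper_subclass_dihedral_bounded[of D] Cons.prems by auto
  moreover obtain L where "\<And>n f. (n, f) \<in> class_comps Cs \<Longrightarrow> dihedral_bounded L n f"
    using Cons by auto
  ultimately have "dihedral_bounded (K + L) n f" if "(n, f) \<in> class_comps (D # Cs)" for n f
    using that by (auto simp: class_comps_simps class_comp_def intro: dihedral_bounded_comp)
  then show ?case by blast
qed

text \<open>This reflection has offset \<open>N + 1\<close> modulo \<open>2 * N\<close>, whose
  representative of least absolute value is \<open>1 - N\<close>, already beyond \<open>K\<close>.
  The values at 1 and 2 suffice to see this and to exclude rotations.\<close>

lemma not_dihedral_bounded_balanced:
  assumes "perm_sum (decr_perm N) (decr_perm N) = (n, f)" "N \<ge> 2" "K + 1 < int N"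
  shows "\<not> dihedral_bounded K n f"
proof
  assume "dihedral_bounded K n f"
  then obtain s c where s: "s = 1 \<or> s = -1" and c: "\<bar>c\<bar> \<le> K"
    and f: "\<And>i. i \<in> {1..n} \<Longrightarrow> int n dvd int (f i) - (s * int i + c)"
    unfolding dihedral_bounded_def cong_iff_dvd_diff by blast
  have n: "n = 2 * N" using perm_sum_decr_perm(1)[OF assms(1)] by simp
  have f1: "int n dvd int N - (s + c)" and f2: "int n dvd int N - 1 - (2 * s + c)"
    using f[of 1] f[of 2] assms(2) n perm_sum_decr_perm(2)[OF assms(1), of 1]
      perm_sum_decr_perm(2)[OF assms(1), of 2]
    by (auto simp: of_nat_diff algebra_simps)
  show False
  proof (cases "s = 1")
    case True
    \<comment> \<open>A rotation increases by 1 modulo \<open>n\<close> from 1 to 2, whereas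
      \<open>f\<close> drops from \<open>N\<close> to \<open>N - 1\<close>.\<close>
    then have "int n dvd 2" using dvd_diff[OF f1 f2] by simp
    then show False using zdvd_imp_le[of "int n" 2] n assms(2) by simp
  next
    case False
    then have "int n dvd int N + 1 - c" using s f1 by (simp add: algebra_simps)
    moreover have "0 < int N + 1 - c" "int N + 1 - c < int n" using n c assms(3) by auto
    ultimately show False using zdvd_imp_le by fastforce
  qed
qed

theorem theorem5p1:
  shows "\<not> composable (layered 2)"
proof
  assume "composable (layered 2)"
  then obtain Cs where Cs: "\<forall>D\<in>set Cs. perm_class D \<and> D \<subset> layered 2"
    and sub: "layered 2 \<subseteq> class_comps Cs"
    unfolding composable_def k_composable_def by blast
  obtain K where K: "\<And>n f. (n, f) \<in> class_comps Cs \<Longrightarrow> dihedral_bounded K n f"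
    using class_comps_dihedral_bounded[OF Cs] by blast
  \<comment> \<open>This gives both \<open>N \<ge> 2\<close> and \<open>K + 1 < int N\<close>,
    whatever the sign of \<open>K\<close>.\<close>
  define N where "N = nat \<bar>K\<bar> + 2"
  obtain n f where nf: "perm_sum (decr_perm N) (decr_perm N) = (n, f)" by fastforce
  then have "(n, f) \<in> class_comps Cs"
    using sub unfolding layered_2_eq by (metis (mono_tags, lifting) mem_Collect_eq subsetD)
  then show False
    using K not_dihedral_bounded_balanced[OF nf, of K] unfolding N_def by force
qed

end
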